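(* Let $(X,\Sigma,m)$ be a non-atomic probability space and let $\tau:X\to X$ be an invertible, aperiodic, $m$-preserving transformation. Then the system $(X,\Sigma,m,\tau)$ possesses a fat tower; that is, there is a sequence of pairwise disjoint columns $C_1,C_2,\dots$ for $\tau$, of heights $k_1,k_2,\dots$ respectively, such that $$\sum_{n=1}^\infty k_n\cdot m(C_n)=\infty .$$
   Context: Invertible means that $\tau$ is a bijection with $\tau$ and $\tau^{-1}$ both measurable. Aperiodic: for every integer $n\ge 1$ and every $A\in\Sigma$ with $m(A)>0$ there is a measurable $D\subset A$ with $m(D\,\triangle\,\tau^{n}D)>0$. On a standard (Lebesgue) probability space this is equivalent to saying that the set of periodic points of $\tau$ has measure zero. A column of height $k$ (with $k\ge 1$ an integer) over a base $B\in\Sigma$ for $\tau$ consists of pairwise disjoint sets $\{B,\tau B,\tau^2B,\dots,\tau^{k-1}B\}$; the set $\tau^iB$ is the $i$th level of the column. The column $C$ is identified with the union of its levels, so $m(C)=m\big(\bigcup_{i=0}^{k-1}\tau^iB\big)=k\cdot m(B)$, and two columns are disjoint if these unions are disjoint. A tower for $\tau$ is a (finite or infinite) sequence of pairwise disjoint columns $\{C_n\}$ of heights $\{k_n\}$. A fat tower for $\tau$ is a tower for which $\sum_{n=1}^\infty k_n\cdot m(C_n)=\infty$. *)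

theory Defs
  imports "HOL-Probability.Probability"
begin

definition nonatomic :: "'a measure \<Rightarrow> bool" where
  "nonatomic M \<longleftrightarrow> (\<forall>A\<in>sets M. 0 < emeasure M A \<longrightarrow>
     (\<exists>B\<in>sets M. B \<subseteq> A \<and> 0 < emeasure M B \<and> emeasure M B < emeasure M A))"

definition measure_preserving :: "'a measure \<Rightarrow> ('a \<Rightarrow> 'a) \<Rightarrow> bool" where
  "measure_preserving M \<tau> \<longleftrightarrow> \<tau> \<in> M \<rightarrow>\<^sub>M M \<and>
     (\<forall>A\<in>sets M. emeasure M (\<tau> -` A \<inter> space M) = emeasure M A)"

definition invertible_transformation :: "'a measure \<Rightarrow> ('a \<Rightarrow> 'a) \<Rightarrow> bool" where
  "invertible_transformation M \<tau> \<longleftrightarrow> bij_betw \<tau> (space M) (space M) \<and>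
     \<tau> \<in> M \<rightarrow>\<^sub>M M \<and> inv_into (space M) \<tau> \<in> M \<rightarrow>\<^sub>M M"

definition aperiodic :: "'a measure \<Rightarrow> ('a \<Rightarrow> 'a) \<Rightarrow> bool" where
  "aperiodic M \<tau> \<longleftrightarrow> (\<forall>n\<ge>1. \<forall>A\<in>sets M. 0 < emeasure M A \<longrightarrow>
     (\<exists>D\<in>sets M. D \<subseteq> A \<and> 0 < emeasure M (sym_diff D ((\<tau> ^^ n) ` D))))"

(* A column is given by its base B and its height k; its i-th level is (\<tau> ^^ i) ` B, i < k. *)
definition column :: "'a measure \<Rightarrow> ('a \<Rightarrow> 'a) \<Rightarrow> 'a set \<Rightarrow> nat \<Rightarrow> bool" where
  "column M \<tau> B k \<longleftrightarrow> B \<in> sets M \<and> 1 \<le> k \<and> disjoint_family_on (\<lambda>i. (\<tau> ^^ i) ` B) {..<k}"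

definition column_union :: "('a \<Rightarrow> 'a) \<Rightarrow> 'a set \<Rightarrow> nat \<Rightarrow> 'a set" where
  "column_union \<tau> B k = (\<Union>i<k. (\<tau> ^^ i) ` B)"

(* N is the number of columns: finite, or \<infinity> for an infinite sequence. Columns are numbered
   from 0, and B n and k n are irrelevant for n \<ge> N. *)
definition tower ::
  "'a measure \<Rightarrow> ('a \<Rightarrow> 'a) \<Rightarrow> enat \<Rightarrow> (nat \<Rightarrow> 'a set) \<Rightarrow> (nat \<Rightarrow> nat) \<Rightarrow> bool" where
  "tower M \<tau> N B k \<longleftrightarrow> (\<forall>n. enat n < N \<longrightarrow> column M \<tau> (B n) (k n)) \<and>
     disjoint_family_on (\<lambda>n. column_union \<tau> (B n) (k n)) {n. enat n < N}"

(* Only infinite towers can be fat: for a finite tower the sum is finite. *)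
definition fat_tower ::
  "'a measure \<Rightarrow> ('a \<Rightarrow> 'a) \<Rightarrow> (nat \<Rightarrow> 'a set) \<Rightarrow> (nat \<Rightarrow> nat) \<Rightarrow> bool" where
  "fat_tower M \<tau> B k \<longleftrightarrow> tower M \<tau> \<infinity> B k \<and>
     (\<Sum>n. of_nat (k n) * emeasure M (column_union \<tau> (B n) (k n))) = \<infinity>"

end

(* Columns over the sets {x in A. x returns to A for the first time at time n}, of height n, form a
   tower, and this tower is fat when the return time to A is not square integrable. Such an A is
   obtained as the complement of the union of U_0, U_1, ..., where U_j consists of the lowest
   4^j levels over the base E_j of a maximal tower of height 8^(j+1). The orbit of any point that
   meets U_j stays outside A for at least 4^j steps. Maximality makes the translates of E_j cover
   the space up to a null set, so U_j occupies a fraction at least 2^-(j+4) of every invariant set;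
   hence the sum is at least of order 4^j * 2^-j for every j. Invariant sets enter because tau need
   not be ergodic. *)
theory Submission
  imports Defs
begin

section \<open>Exhaustion in a finite measure space\<close>

text \<open>Greedy choice: \<open>f (Suc n)\<close> extends \<open>f n\<close> and comes within
  (1/2)^n of the supremum \<open>s (f n)\<close> of the measures available above \<open>f n\<close>.
  Any member of \<open>F\<close> above the union competes in all these suprema. Maximality is thus
  meant in measure, not for inclusion.\<close>

lemma (in finite_measure) exhaustion:
  assumes F: "F \<subseteq> sets M" "F \<noteq> {}"
    and UN: "\<And>E :: nat \<Rightarrow> 'a set. range E \<subseteq> F \<Longrightarrow> incseq E \<Longrightarrow> (\<Union>n. E n) \<in> F"
  obtains E where "E \<in> F" "\<And>E'. E' \<in> F \<Longrightarrow> E \<subseteq> E' \<Longrightarrow> measure M E' \<le> measure M E"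
proof -
  define s where "s E = Sup (measure M ` {E' \<in> F. E \<subseteq> E'})" for E
  have bdd: "bdd_above (measure M ` {E' \<in> F. E \<subseteq> E'})" for E
    using bounded_measure by (auto intro!: bdd_aboveI2)
  have le_s: "measure M E' \<le> s E" if "E' \<in> F" "E \<subseteq> E'" for E E'
    unfolding s_def using that by (intro cSup_upper bdd) auto
  have step: "\<exists>E'. E' \<in> F \<and> (E \<subseteq> E' \<and> s E - (1/2)^n \<le> measure M E')" if "E \<in> F" for E and n :: nat
  proof -
    have "measure M ` {E' \<in> F. E \<subseteq> E'} \<noteq> {}" using that by auto
    then have "\<exists>r\<in>measure M ` {E' \<in> F. E \<subseteq> E'}. s E - (1/2)^n < r"
      unfolding s_def by (subst less_cSup_iff[symmetric]) (simp_all add: bdd)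
    then show ?thesis by (auto intro: less_imp_le)
  qed
  have "\<exists>f. \<forall>n. f n \<in> F \<and> (f n \<subseteq> f (Suc n) \<and> s (f n) - (1/2)^n \<le> measure M (f (Suc n)))"
    by (rule dependent_nat_choice) (use F(2) step in auto)
  then obtain f where f: "\<And>n. f n \<in> F" "\<And>n. f n \<subseteq> f (Suc n)"
    "\<And>n. s (f n) - (1/2)^n \<le> measure M (f (Suc n))"
    by blast
  have inc: "incseq f" using f(2) by (rule incseq_SucI)
  show ?thesis
  proof
    show U: "(\<Union>n. f n) \<in> F" using f(1) inc by (intro UN) auto
    fix E' assume E': "E' \<in> F" "(\<Union>n. f n) \<subseteq> E'"
    have "measure M E' - (1/2)^n \<le> measure M (\<Union>n. f n)" for n
    proof -
      have "measure M E' \<le> s (f n)" using E' by (intro le_s) auto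
      moreover have "measure M (f (Suc n)) \<le> measure M (\<Union>n. f n)"
        using U F(1) by (intro finite_measure_mono) auto
      ultimately show ?thesis using f(3)[of n] by linarith
    qed
    moreover have "(\<lambda>n. measure M E' - (1/2)^n) \<longlonglongrightarrow> measure M E' - 0"
      by (intro tendsto_intros LIMSEQ_power_zero) auto
    ultimately show "measure M E' \<le> measure M (\<Union>n. f n)"
      using LIMSEQ_le_const2[of _ "measure M E' - 0"] by auto
  qed
qed

section \<open>Iterates of an invertible measure-preserving map\<close>

locale invertible_mpt = prob_space M for M :: "'a measure" +
  fixes \<tau> :: "'a \<Rightarrow> 'a"
  assumes invertible: "invertible_transformation M \<tau>"
    and preserving: "measure_preserving M \<tau>"
begin

lemma bij_funpow: "bij_betw (\<tau> ^^ i) (space M) (space M)"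
  using invertible unfolding invertible_transformation_def by (blast intro: bij_betw_funpow)

lemma funpow_space: "x \<in> space M \<Longrightarrow> (\<tau> ^^ i) x \<in> space M"
  using bij_funpow[of i] by (auto dest: bij_betwE)

lemma funpow_eq_iff:
  "x \<in> space M \<Longrightarrow> y \<in> space M \<Longrightarrow> (\<tau> ^^ i) x = (\<tau> ^^ i) y \<longleftrightarrow> x = y"
  using bij_funpow[of i] by (auto simp: bij_betw_def inj_on_def)

lemma funpow_cancel:
  assumes "x \<in> space M" "y \<in> space M" "(\<tau> ^^ i) x = (\<tau> ^^ j) y" "i \<le> j"
  shows "x = (\<tau> ^^ (j - i)) y"
proof -
  have "(\<tau> ^^ j) y = (\<tau> ^^ i) ((\<tau> ^^ (j - i)) y)"
    using assms(4) by (metis comp_apply funpow_add le_add_diff_inverse)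
  then show ?thesis using assms funpow_eq_iff funpow_space by metis
qed

lemma vimage_sets [measurable]:
  assumes "A \<in> sets M" shows "(\<tau> ^^ i) -` A \<inter> space M \<in> sets M"
proof -
  have [measurable]: "\<tau> \<in> M \<rightarrow>\<^sub>M M" using preserving by (simp add: measure_preserving_def)
  have "(\<tau> ^^ i) \<in> M \<rightarrow>\<^sub>M M" by measurable
  then show ?thesis using assms by (rule measurable_sets)
qed

lemma measure_vimage:
  assumes A: "A \<in> sets M" shows "measure M ((\<tau> ^^ i) -` A \<inter> space M) = measure M A"
proof (induction i)
  case 0
  then show ?case using sets.sets_into_space[OF A] by (simp add: Int_absorb2)
next
  case (Suc i)
  have "(\<tau> ^^ Suc i) -` A \<inter> space M = \<tau> -` ((\<tau> ^^ i) -` A \<inter> space M) \<inter> space M"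
    using funpow_space[of _ 1] by (auto simp del: funpow.simps simp: funpow_Suc_right)
  then have "measure M ((\<tau> ^^ Suc i) -` A \<inter> space M) = measure M ((\<tau> ^^ i) -` A \<inter> space M)"
    using preserving vimage_sets[OF A, of i] unfolding measure_preserving_def measure_def by metis
  then show ?case using Suc by (simp only:)
qed

lemma image_sets [measurable]:
  assumes A: "A \<in> sets M" shows "(\<tau> ^^ i) ` A \<in> sets M"
proof (induction i)
  case 0
  then show ?case using A by simp
next
  case (Suc i)
  let ?B = "(\<tau> ^^ i) ` A"
  let ?g = "inv_into (space M) \<tau>"
  have bij: "bij_betw \<tau> (space M) (space M)" and inv: "?g \<in> M \<rightarrow>\<^sub>M M"
    using invertible by (auto simp: invertible_transformation_def)
  have B: "?B \<subseteq> space M" using Suc by (rule sets.sets_into_space)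
  \<comment> \<open>An image is a preimage under the inverse, which is measurable by
    invertibility.\<close>
  have "\<tau> ` ?B = ?g -` ?B \<inter> space M"
  proof (intro equalityI subsetI)
    fix y assume "y \<in> \<tau> ` ?B"
    then obtain x where x: "x \<in> ?B" "y = \<tau> x" by blast
    then have "?g y = x" "y \<in> space M"
      using B bij by (auto simp: subset_iff bij_betw_inv_into_left[OF bij] dest: bij_betwE)
    then show "y \<in> ?g -` ?B \<inter> space M" using x by simp
  next
    fix y assume y: "y \<in> ?g -` ?B \<inter> space M"
    then have "y = \<tau> (?g y)" using bij by (simp add: bij_betw_inv_into_right)
    then show "y \<in> \<tau> ` ?B" using y by blast
  qed
  moreover have "(\<tau> ^^ Suc i) ` A = \<tau> ` ?B" by (simp add: image_comp)
  ultimately show ?case using measurable_sets[OF inv Suc] by simp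
qed

lemma measure_image:
  assumes A: "A \<in> sets M" shows "measure M ((\<tau> ^^ i) ` A) = measure M A"
proof -
  have "(\<tau> ^^ i) -` ((\<tau> ^^ i) ` A) \<inter> space M = A"
    using sets.sets_into_space[OF A] funpow_eq_iff by blast
  then show ?thesis using measure_vimage[OF image_sets[OF A], of i i] by simp
qed

text \<open>By injectivity, a common point of levels i < j pulls back to a common point of the base
  and level j - i.\<close>

lemma disjoint_levels:
  assumes E: "E \<subseteq> space M" and disj: "\<And>n. 0 < n \<Longrightarrow> n < h \<Longrightarrow> E \<inter> (\<tau> ^^ n) ` E = {}"
  shows "disjoint_family_on (\<lambda>i. (\<tau> ^^ i) ` E) {..<h}"
proof -
  have "False" if "i < j" "j < h" "x \<in> E" "y \<in> E" "(\<tau> ^^ i) x = (\<tau> ^^ j) y" for i j x y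
  proof -
    have "x = (\<tau> ^^ (j - i)) y" using that E by (intro funpow_cancel) auto
    then have "x \<in> E \<inter> (\<tau> ^^ (j - i)) ` E" using that by blast
    then show False using disj[of "j - i"] that by simp
  qed
  then have "(\<tau> ^^ i) ` E \<inter> (\<tau> ^^ j) ` E = {}" if "i < j" "j < h" for i j
    using that by blast
  then show ?thesis unfolding disjoint_family_on_def
    by (metis Int_commute lessThan_iff linorder_neqE_nat)
qed

section \<open>Maximal towers\<close>

text \<open>The base is shrunk once for each exponent, since disjointness from an image passes to
  subsets. For exponent \<open>h\<close>, removing from \<open>D'\<close> its own
  \<open>h\<close>-th image leaves a set disjoint from its \<open>h\<close>-th image.\<close>

lemma exists_disjoint_base:
  assumes ap: "aperiodic M \<tau>" and A: "A \<in> sets M" "0 < measure M A"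
  shows "\<exists>D\<in>sets M. D \<subseteq> A \<and> 0 < measure M D \<and> (\<forall>n. 0 < n \<longrightarrow> n < h \<longrightarrow> D \<inter> (\<tau> ^^ n) ` D = {})"
proof (induction h)
  case 0
  then show ?case using A by auto
next
  case (Suc h)
  then obtain D where D: "D \<in> sets M" "D \<subseteq> A" "0 < measure M D"
    "\<And>n. 0 < n \<Longrightarrow> n < h \<Longrightarrow> D \<inter> (\<tau> ^^ n) ` D = {}" by auto
  show ?case
  proof (cases "h = 0")
    case True
    then show ?thesis using D by auto
  next
    case False
    then obtain D' where D': "D' \<in> sets M" "D' \<subseteq> D" "0 < emeasure M (sym_diff D' ((\<tau> ^^ h) ` D'))"
      using ap[unfolded aperiodic_def, rule_format, of h D] D(1,3)
      by (auto simp: emeasure_eq_measure)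
    let ?S = "(\<tau> ^^ h) ` D'"
    have S: "?S \<in> sets M" using D' by simp
    have "measure M (sym_diff D' ?S) = measure M (D' - ?S) + measure M (?S - D')"
      using S D'(1) by (intro finite_measure_Union) auto
    \<comment> \<open>\<open>D'\<close> and its image have equal measure, so both halves of the
      symmetric difference do too, and neither is null.\<close>
    moreover have "measure M (?S - D') = measure M (D' - ?S)"
      using finite_measure_Diff'[OF S D'(1)] finite_measure_Diff'[OF D'(1) S] measure_image[OF D'(1), of h]
      by (simp add: Int_commute)
    ultimately have "0 < measure M (D' - ?S)"
      using D'(3) by (simp add: emeasure_eq_measure)
    moreover have "(D' - ?S) \<inter> (\<tau> ^^ n) ` (D' - ?S) = {}" if "0 < n" "n < Suc h" for n
    proof (cases "n = h")
      case False
      then show ?thesis using D(4)[of n] that D'(2) by auto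
    qed auto
    ultimately show ?thesis using S D' D(2) by (intro bexI[of _ "D' - ?S"]) auto
  qed
qed

text \<open>Maximality is recorded through its consequence: almost every orbit meets
  \<open>E\<close> within fewer than \<open>h\<close> steps, forward or backward.\<close>

definition maximal_base :: "nat \<Rightarrow> 'a set \<Rightarrow> bool" where
  "maximal_base h E \<longleftrightarrow> E \<in> sets M \<and> (\<forall>n. 0 < n \<longrightarrow> n < h \<longrightarrow> E \<inter> (\<tau> ^^ n) ` E = {}) \<and>
    measure M (space M - (\<Union>i<h. (\<tau> ^^ i) ` E \<union> ((\<tau> ^^ i) -` E \<inter> space M))) = 0"

lemma maximal_baseD:
  assumes "maximal_base h E"
  shows "E \<in> sets M" and "0 < n \<Longrightarrow> n < h \<Longrightarrow> E \<inter> (\<tau> ^^ n) ` E = {}"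
    and "measure M (space M - (\<Union>i<h. (\<tau> ^^ i) ` E \<union> ((\<tau> ^^ i) -` E \<inter> space M))) = 0"
  using assms by (simp_all add: maximal_base_def)

text \<open>Exhaustion gives an admissible \<open>E\<close> of unimprovable measure. If the
  uncovered set \<open>?R\<close> had positive measure, it would contain a base \<open>D\<close>
  that could be added to \<open>E\<close>.\<close>

lemma exists_maximal_base:
  assumes ap: "aperiodic M \<tau>" and h: "0 < h"
  shows "\<exists>E. maximal_base h E"
proof -
  define F where "F = {E \<in> sets M. \<forall>n. 0 < n \<longrightarrow> n < h \<longrightarrow> E \<inter> (\<tau> ^^ n) ` E = {}}"
  have UN: "(\<Union>n. E n) \<in> F" if F: "range E \<subseteq> F" and inc: "incseq E" for E
  proof -
    have "False" if n: "0 < n" "n < h" and "(\<tau> ^^ n) y \<in> E a" "y \<in> E b" for n a b y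
    proof -
      \<comment> \<open>Two points of an increasing union already lie in one common member.\<close>
      have "E a \<subseteq> E (max a b)" "E b \<subseteq> E (max a b)" by (simp_all add: incseqD[OF inc])
      then have "(\<tau> ^^ n) y \<in> E (max a b)" "y \<in> E (max a b)"
        using that by blast+
      moreover have "E (max a b) \<in> F" using F by auto
      ultimately show False using n unfolding F_def by blast
    qed
    then have "(\<Union>n. E n) \<inter> (\<tau> ^^ n) ` (\<Union>n. E n) = {}" if "0 < n" "n < h" for n
      using that by blast
    moreover have "(\<Union>n. E n) \<in> sets M" using F by (intro sets.countable_UN) (auto simp: F_def)
    ultimately show ?thesis unfolding F_def by blast
  qed
  have "F \<subseteq> sets M" "{} \<in> F" by (auto simp: F_def)
  then obtain E where EF: "E \<in> F"
    and max: "\<And>E'. E' \<in> F \<Longrightarrow> E \<subseteq> E' \<Longrightarrow> measure M E' \<le> measure M E"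
    using exhaustion[of F, OF _ _ UN] by blast
  have E: "E \<in> sets M" and disj: "\<And>n. 0 < n \<Longrightarrow> n < h \<Longrightarrow> E \<inter> (\<tau> ^^ n) ` E = {}"
    using EF by (auto simp: F_def)
  let ?R = "space M - (\<Union>i<h. (\<tau> ^^ i) ` E \<union> ((\<tau> ^^ i) -` E \<inter> space M))"
  have "measure M ?R = 0"
  proof (rule ccontr)
    assume "measure M ?R \<noteq> 0"
    then have "0 < measure M ?R" by (simp add: zero_less_measure_iff)
    moreover have "?R \<in> sets M" using E by measurable
    ultimately obtain D where D: "D \<in> sets M" "D \<subseteq> ?R" "0 < measure M D"
      "\<And>n. 0 < n \<Longrightarrow> n < Suc h \<Longrightarrow> D \<inter> (\<tau> ^^ n) ` D = {}"
      using exists_disjoint_base[OF ap, of ?R "Suc h"] by blast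
    have "(E \<union> D) \<inter> (\<tau> ^^ n) ` (E \<union> D) = {}" if n: "0 < n" "n < h" for n
    proof -
      \<comment> \<open>The first holds because \<open>D\<close> avoids the images of
        \<open>E\<close>, the second because it avoids the preimages.\<close>
      have "D \<inter> (\<tau> ^^ n) ` E = {}" "E \<inter> (\<tau> ^^ n) ` D = {}" using D(2) n by auto
      then show ?thesis using disj[OF n] D(4)[of n] n by (auto simp: image_Un)
    qed
    then have "E \<union> D \<in> F" using E D(1) by (auto simp: F_def)
    then have "measure M (E \<union> D) \<le> measure M E" by (intro max) auto
    moreover have "E \<subseteq> (\<Union>i<h. (\<tau> ^^ i) ` E)" using h by (auto intro!: bexI[of _ 0])
    then have "E \<inter> D = {}" using D(2) by blast
    then have "measure M (E \<union> D) = measure M E + measure M D"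
      using E D(1) by (intro finite_measure_Union)
    ultimately show False using D(3) by simp
  qed
  with E disj have "maximal_base h E" by (simp add: maximal_base_def)
  then show ?thesis ..
qed

lemma measure_levels:
  assumes E: "E \<in> sets M" and disj: "\<And>n. 0 < n \<Longrightarrow> n < h \<Longrightarrow> E \<inter> (\<tau> ^^ n) ` E = {}"
  shows "measure M (\<Union>i<h. (\<tau> ^^ i) ` E) = h * measure M E"
proof -
  have "measure M (\<Union>i<h. (\<tau> ^^ i) ` E) = (\<Sum>i<h. measure M ((\<tau> ^^ i) ` E))"
    using disjoint_levels[OF sets.sets_into_space[OF E] disj] E
    by (intro finite_measure_finite_Union) auto
  then show ?thesis by (simp add: measure_image E)
qed

text \<open>A point of the invariant set \<open>Z\<close> that is covered by a translate of
  \<open>E\<close> is covered by the same translate of \<open>E \<inter> Z\<close>. So 2h translates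
  of \<open>E \<inter> Z\<close>, all of equal measure, cover \<open>Z\<close> up to a null
  set.\<close>

lemma measure_invariant_le:
  assumes Z: "Z \<in> sets M" and inv: "\<And>x. x \<in> space M \<Longrightarrow> \<tau> x \<in> Z \<longleftrightarrow> x \<in> Z"
    and E: "E \<in> sets M"
    and cover: "measure M (space M - (\<Union>i<h. (\<tau> ^^ i) ` E \<union> ((\<tau> ^^ i) -` E \<inter> space M))) = 0"
  shows "measure M Z \<le> 2 * h * measure M (E \<inter> Z)"
proof -
  let ?R = "space M - (\<Union>i<h. (\<tau> ^^ i) ` E \<union> ((\<tau> ^^ i) -` E \<inter> space M))"
  let ?S = "\<lambda>i. (\<tau> ^^ i) ` (E \<inter> Z) \<union> ((\<tau> ^^ i) -` (E \<inter> Z) \<inter> space M)"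
  have EZ: "E \<inter> Z \<in> sets M" using E Z by simp
  have S: "?S i \<in> sets M" for i using EZ by measurable
  have invn: "(\<tau> ^^ i) x \<in> Z \<longleftrightarrow> x \<in> Z" if "x \<in> space M" for i x
    using that by (induction i) (simp_all add: inv funpow_space)
  have "Z \<subseteq> ?R \<union> (\<Union>i<h. ?S i)"
  proof
    fix x assume x: "x \<in> Z"
    then have sp: "x \<in> space M" using sets.sets_into_space[OF Z] by blast
    show "x \<in> ?R \<union> (\<Union>i<h. ?S i)"
    proof (cases "x \<in> ?R")
      case False
      then obtain i where i: "i < h" "x \<in> (\<tau> ^^ i) ` E \<or> (\<tau> ^^ i) x \<in> E" using sp by blast
      have "x \<in> ?S i"
        using i(2)
      proof
        assume "x \<in> (\<tau> ^^ i) ` E"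
        then obtain y where "y \<in> E" "x = (\<tau> ^^ i) y" by blast
        moreover from this have "y \<in> Z"
          using x invn[of y i] sets.sets_into_space[OF E] by blast
        ultimately show ?thesis by blast
      qed (use x sp invn in blast)
      then show ?thesis using i(1) by blast
    qed (rule UnI1)
  qed
  then have "measure M Z \<le> measure M (?R \<union> (\<Union>i<h. ?S i))"
    using E S by (intro finite_measure_mono) auto
  also have "\<dots> \<le> measure M ?R + measure M (\<Union>i<h. ?S i)"
    using E S by (intro measure_Un_le) auto
  also have "measure M (\<Union>i<h. ?S i) \<le> (\<Sum>i<h. measure M (?S i))"
    using S by (intro finite_measure_subadditive_finite) auto
  also have "(\<Sum>i<h. measure M (?S i)) \<le> (\<Sum>i<h. 2 * measure M (E \<inter> Z))"
  proof (intro sum_mono)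
    fix i
    have "measure M (?S i) \<le> measure M ((\<tau> ^^ i) ` (E \<inter> Z)) + measure M ((\<tau> ^^ i) -` (E \<inter> Z) \<inter> space M)"
      using EZ by (intro measure_Un_le image_sets vimage_sets)
    then show "measure M (?S i) \<le> 2 * measure M (E \<inter> Z)"
      using measure_image[OF EZ, of i] measure_vimage[OF EZ, of i] by linarith
  qed
  finally show ?thesis using cover by simp
qed

section \<open>Points that visit a set infinitely often in both time directions\<close>

definition recurrent :: "'a set \<Rightarrow> 'a set" where
  "recurrent A = {x \<in> space M. \<forall>n. (\<exists>i\<ge>n. (\<tau> ^^ i) x \<in> A) \<and> (\<exists>i\<ge>n. x \<in> (\<tau> ^^ i) ` A)}"

lemma recurrent_sets:
  assumes A: "A \<in> sets M" shows "recurrent A \<in> sets M"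
proof -
  have "recurrent A = (\<Inter>n. (\<Union>i\<in>{n..}. (\<tau> ^^ i) -` A \<inter> space M) \<inter> (\<Union>i\<in>{n..}. (\<tau> ^^ i) ` A))"
    by (auto simp: recurrent_def Bex_def)
  also have "\<dots> \<in> sets M" using A by measurable
  finally show ?thesis .
qed

text \<open>Passing from x to \<open>\<tau> x\<close> shifts all visit times by one, which does not
  affect whether they are unbounded in either direction.\<close>

lemma recurrent_invariant:
  assumes A: "A \<subseteq> space M" and x: "x \<in> space M"
  shows "\<tau> x \<in> recurrent A \<longleftrightarrow> x \<in> recurrent A"
proof -
  have 1: "(\<tau> ^^ i) (\<tau> x) \<in> A \<longleftrightarrow> (\<tau> ^^ Suc i) x \<in> A" for i
    by (simp only: funpow_Suc_right o_apply)
  have 2: "\<tau> x \<in> (\<tau> ^^ Suc i) ` A \<longleftrightarrow> x \<in> (\<tau> ^^ i) ` A" for i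
  proof -
    have "\<tau> x = (\<tau> ^^ Suc i) y \<longleftrightarrow> x = (\<tau> ^^ i) y" if "y \<in> A" for y
      using that A x funpow_eq_iff[of x "(\<tau> ^^ i) y" 1] funpow_space[of y i] by auto
    then show ?thesis by blast
  qed
  have shift: "(\<forall>n. \<exists>i\<ge>n. P (Suc i)) \<longleftrightarrow> (\<forall>n::nat. \<exists>i\<ge>n. P i)" for P
    by (metis Suc_le_D Suc_le_mono le_SucI)
  have "(\<forall>n. \<exists>i\<ge>n. (\<tau> ^^ i) (\<tau> x) \<in> A) \<longleftrightarrow> (\<forall>n. \<exists>i\<ge>n. (\<tau> ^^ i) x \<in> A)"
    unfolding 1 by (rule shift)
  moreover have "(\<forall>n. \<exists>i\<ge>n. \<tau> x \<in> (\<tau> ^^ i) ` A) \<longleftrightarrow> (\<forall>n. \<exists>i\<ge>n. x \<in> (\<tau> ^^ i) ` A)"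
    using shift[of "\<lambda>i. \<tau> x \<in> (\<tau> ^^ i) ` A"] unfolding 2 by simp
  moreover have "\<tau> x \<in> space M" using funpow_space[OF x, of 1] by simp
  ultimately show ?thesis using x unfolding recurrent_def by blast
qed

lemma measure_limsup_ge:
  fixes S :: "nat \<Rightarrow> 'a set"
  assumes S: "\<And>i. S i \<in> sets M" and c: "\<And>i. c \<le> measure M (S i)"
  shows "c \<le> measure M (\<Inter>n. \<Union>i\<in>{n..}. S i)"
proof -
  have "(\<lambda>n. measure M (\<Union>i\<in>{n..}. S i)) \<longlonglongrightarrow> measure M (\<Inter>n. \<Union>i\<in>{n..}. S i)"
    using S by (intro finite_Lim_measure_decseq) (fastforce simp: decseq_def)+
  moreover have "c \<le> measure M (\<Union>i\<in>{n..}. S i)" for n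
    by (rule order_trans[OF c[of n]], rule finite_measure_mono) (use S in auto)
  ultimately show ?thesis by (meson LIMSEQ_le_const)
qed

text \<open>The set is the intersection of the limsup of the images of \<open>A\<close> and the
  limsup of its preimages. Each has measure at least that of \<open>A\<close>, and their union has
  measure at most 1.\<close>

lemma measure_recurrent_ge:
  assumes A: "A \<in> sets M" shows "2 * measure M A - 1 \<le> measure M (recurrent A)"
proof -
  let ?P = "\<Inter>n. \<Union>i\<in>{n..}. (\<tau> ^^ i) ` A"
  let ?Q = "\<Inter>n. \<Union>i\<in>{n..}. (\<tau> ^^ i) -` A \<inter> space M"
  have P: "?P \<in> sets M" and Q: "?Q \<in> sets M" using A by measurable
  have "measure M A \<le> measure M ?P" "measure M A \<le> measure M ?Q"
    by (intro measure_limsup_ge image_sets vimage_sets A; simp add: A measure_image measure_vimage)+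
  moreover have "recurrent A = ?P \<inter> ?Q" by (auto simp: recurrent_def Bex_def)
  moreover have "measure M (?P \<union> ?Q) = measure M ?P + measure M ?Q - measure M (?P \<inter> ?Q)"
    using P Q by (intro measure_Un3) (simp_all add: fmeasurable_eq_sets)
  moreover have "measure M (?P \<union> ?Q) \<le> 1" by (rule prob_le_1)
  ultimately show ?thesis by simp
qed

section \<open>The tower of first return times\<close>

text \<open>For n = 0 this is all of \<open>A\<close>; the tower below therefore uses the indices
  \<open>Suc n\<close>.\<close>

definition return_set :: "'a set \<Rightarrow> nat \<Rightarrow> 'a set" where
  "return_set A n = {x \<in> A. (\<tau> ^^ n) x \<in> A \<and> (\<forall>i. 0 < i \<and> i < n \<longrightarrow> (\<tau> ^^ i) x \<notin> A)}"

lemma return_set_sets: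
  assumes A: "A \<in> sets M" shows "return_set A n \<in> sets M"
proof -
  have "return_set A n = A \<inter> ((\<tau> ^^ n) -` A \<inter> space M) - (\<Union>i\<in>{0<..<n}. (\<tau> ^^ i) -` A \<inter> space M)"
    using sets.sets_into_space[OF A] unfolding return_set_def by auto
  also have "\<dots> \<in> sets M" using A by measurable
  finally show ?thesis .
qed

text \<open>If i < j, cancelling gives \<open>x = (\<tau> ^^ (j - i)) y\<close>, a return of y to
  \<open>A\<close> before time n. Allowing m and n to differ serves both levels of one column and
  levels of two columns.\<close>

lemma return_levels_inj:
  assumes A: "A \<subseteq> space M" and x: "x \<in> return_set A m" and y: "y \<in> return_set A n"
    and "i < m" "j < n" "(\<tau> ^^ i) x = (\<tau> ^^ j) y"
  shows "i = j \<and> x = y"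
proof -
  have sp: "x \<in> space M" "y \<in> space M" and xy: "x \<in> A" "y \<in> A"
    using A x y by (auto simp: return_set_def)
  have "\<not> i < j"
  proof
    assume "i < j"
    then have "x = (\<tau> ^^ (j - i)) y" using assms sp by (intro funpow_cancel) auto
    then show False using \<open>i < j\<close> \<open>j < n\<close> y xy unfolding return_set_def by auto
  qed
  moreover have "\<not> j < i"
  proof
    assume "j < i"
    then have "y = (\<tau> ^^ (i - j)) x" using assms sp by (intro funpow_cancel) auto
    then show False using \<open>j < i\<close> \<open>i < m\<close> x xy unfolding return_set_def by auto
  qed
  ultimately show ?thesis using assms sp funpow_eq_iff by (metis linorder_neqE_nat)
qed

lemma tower_return:
  assumes A: "A \<in> sets M"
  shows "tower M \<tau> \<infinity> (\<lambda>n. return_set A (Suc n)) Suc"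
proof -
  note inj = return_levels_inj[OF sets.sets_into_space[OF A]]
  have "column M \<tau> (return_set A (Suc n)) (Suc n)" for n
    unfolding column_def disjoint_family_on_def
    using return_set_sets[OF A] inj by (auto simp: disjoint_iff)
  moreover have "disjoint_family (\<lambda>n. column_union \<tau> (return_set A (Suc n)) (Suc n))"
  proof (unfold disjoint_family_on_def, intro ballI impI, rule ccontr)
    fix m n
    assume "m \<noteq> n"
      "column_union \<tau> (return_set A (Suc m)) (Suc m) \<inter> column_union \<tau> (return_set A (Suc n)) (Suc n) \<noteq> {}"
    then obtain i j x y where *: "i < Suc m" "j < Suc n" "x \<in> return_set A (Suc m)"
      "y \<in> return_set A (Suc n)" "(\<tau> ^^ i) x = (\<tau> ^^ j) y"
      by (auto simp: column_union_def simp del: funpow.simps)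
    \<comment> \<open>One base point would have two different first return times.\<close>
    then have "x = y" using inj by blast
    with * have "x \<in> A" "(\<tau> ^^ Suc m) x \<in> A" "(\<tau> ^^ Suc n) x \<in> A"
      "\<And>i. 0 < i \<Longrightarrow> i < Suc m \<Longrightarrow> (\<tau> ^^ i) x \<notin> A" "\<And>i. 0 < i \<Longrightarrow> i < Suc n \<Longrightarrow> (\<tau> ^^ i) x \<notin> A"
      unfolding return_set_def by blast+
    then show False using \<open>m \<noteq> n\<close> by (metis Suc_less_eq linorder_neqE_nat zero_less_Suc)
  qed
  ultimately show ?thesis by (simp add: tower_def)
qed

text \<open>Let -i be the time of the last visit of z to \<open>A\<close> up to now, and j that of
  the next one. The point x visited at time -i first returns after i + j steps, and z lies on level
  i over it.\<close>

lemma recurrent_subset_return: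
  assumes A: "A \<subseteq> space M"
  shows "recurrent A \<subseteq> (\<Union>n. column_union \<tau> (return_set A (Suc n)) (Suc n))"
proof
  fix z assume z: "z \<in> recurrent A"
  \<comment> \<open>The present counts as past: a point of \<open>A\<close> has i = 0 and lies on
    the base, while j is positive, so i < i + j.\<close>
  let ?P = "\<lambda>i. z \<in> (\<tau> ^^ i) ` A" and ?Q = "\<lambda>j. 0 < j \<and> (\<tau> ^^ j) z \<in> A"
  define i where "i = (LEAST i. ?P i)"
  define j where "j = (LEAST j. ?Q j)"
  have "\<exists>i. ?P i" using z unfolding recurrent_def by blast
  then have i: "?P i" unfolding i_def by (rule LeastI_ex)
  have "\<exists>j\<ge>1. (\<tau> ^^ j) z \<in> A" using z unfolding recurrent_def by blast
  then have "\<exists>j. ?Q j" by (metis less_le_trans zero_less_one)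
  then have j: "?Q j" unfolding j_def by (rule LeastI_ex)
  obtain x where x: "x \<in> A" "z = (\<tau> ^^ i) x" using i by blast
  have "(\<tau> ^^ l) x \<notin> A" if l: "0 < l" "l < i + j" for l
  proof
    assume lA: "(\<tau> ^^ l) x \<in> A"
    show False
    proof (cases "l \<le> i")
      case True
      then have "z = (\<tau> ^^ (i - l)) ((\<tau> ^^ l) x)"
        using x(2) by (metis comp_apply funpow_add le_add_diff_inverse2)
      then have "?P (i - l)" using lA by blast
      then have "i \<le> i - l" unfolding i_def by (rule Least_le)
      then show False using l True by simp
    next
      case False
      then have "(\<tau> ^^ l) x = (\<tau> ^^ (l - i)) z"
        using x(2) by (metis comp_apply funpow_add le_add_diff_inverse2 nat_le_linear)
      then have "?Q (l - i)" using lA False by simp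
      then have "j \<le> l - i" unfolding j_def by (rule Least_le)
      then show False using l False by simp
    qed
  qed
  moreover have "(\<tau> ^^ (i + j)) x \<in> A"
    using j x(2) by (metis add.commute comp_apply funpow_add)
  ultimately have "x \<in> return_set A (i + j)" using x(1) by (simp add: return_set_def)
  then have "z \<in> column_union \<tau> (return_set A (Suc (i + j - 1))) (Suc (i + j - 1))"
    using j x(2) by (auto simp: column_union_def)
  then show "z \<in> (\<Union>n. column_union \<tau> (return_set A (Suc n)) (Suc n))" by blast
qed

section \<open>A criterion for fatness\<close>

text \<open>An orbit that leaves \<open>A\<close> and meets a level over \<open>E\<close> must have
  entered through \<open>E\<close> after leaving, and then runs through all \<open>h\<close> levels,
  outside \<open>A\<close>, before it returns.\<close>

lemma height_less_return_time:
  assumes A: "A \<subseteq> space M" and E: "E \<subseteq> space M"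
    and avoid: "A \<inter> (\<Union>i<h. (\<tau> ^^ i) ` E) = {}"
    and meet: "(\<Union>i<h. (\<tau> ^^ i) ` E) \<inter> column_union \<tau> (return_set A n) n \<noteq> {}"
  shows "h < n"
proof -
  obtain a b e x where ab: "a < h" "b < n" and e: "e \<in> E" and x: "x \<in> return_set A n"
    and eq: "(\<tau> ^^ a) e = (\<tau> ^^ b) x"
    using meet by (auto simp: column_union_def)
  have sp: "e \<in> space M" "x \<in> space M" and xA: "x \<in> A"
    using A E e x by (auto simp: return_set_def)
  have notA: "(\<tau> ^^ i) e \<notin> A" if "i < h" for i using avoid e that by blast
  \<comment> \<open>Otherwise x, a point of \<open>A\<close>, would itself lie on level a - b over
    \<open>E\<close>.\<close>
  have "a < b"
  proof (rule ccontr)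
    assume "\<not> a < b"
    then have "x = (\<tau> ^^ (a - b)) e" using sp eq by (intro funpow_cancel) auto
    then show False using xA notA[of "a - b"] ab by simp
  qed
  then have e_eq: "e = (\<tau> ^^ (b - a)) x" using sp eq by (intro funpow_cancel) auto
  have "(\<tau> ^^ (n - (b - a))) e = (\<tau> ^^ n) x"
    unfolding e_eq using ab funpow_add[of "n - (b - a)" "b - a" \<tau>] by simp
  then have "(\<tau> ^^ (n - (b - a))) e \<in> A" using x by (simp add: return_set_def)
  then have "h \<le> n - (b - a)" using notA not_le by blast
  then show ?thesis using \<open>a < b\<close> ab by simp
qed

text \<open>Each column that meets the j-th union of levels is higher than \<open>h j\<close>, and
  the columns cover \<open>recurrent A\<close>. So every quantity in \<open>big\<close> is a lower
  bound for the sum.\<close>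

lemma fat_tower_return:
  assumes A: "A \<in> sets M" and E: "\<And>j. E j \<in> sets M"
    and avoid: "\<And>j. A \<inter> (\<Union>i<h j. (\<tau> ^^ i) ` E j) = {}"
    and big: "\<And>c. \<exists>j. c \<le> h j * measure M ((\<Union>i<h j. (\<tau> ^^ i) ` E j) \<inter> recurrent A)"
  shows "fat_tower M \<tau> (\<lambda>n. return_set A (Suc n)) Suc"
proof -
  let ?C = "\<lambda>n. column_union \<tau> (return_set A (Suc n)) (Suc n)"
  let ?s = "\<Sum>n. of_nat (Suc n) * emeasure M (?C n)"
  have C: "?C n \<in> sets M" for n
    unfolding column_union_def using return_set_sets[OF A] by (intro sets.finite_UN) auto
  have disj: "disjoint_family ?C" using tower_return[OF A] by (simp add: tower_def)
  have "ennreal (h j * measure M ((\<Union>i<h j. (\<tau> ^^ i) ` E j) \<inter> recurrent A)) \<le> ?s" for j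
  proof -
    let ?U = "\<Union>i<h j. (\<tau> ^^ i) ` E j"
    have U: "?U \<in> sets M" using E by simp
    have "emeasure M (?U \<inter> recurrent A) \<le> emeasure M (\<Union>n. ?U \<inter> ?C n)"
      using recurrent_subset_return[OF sets.sets_into_space[OF A]] U C by (intro emeasure_mono) auto
    also have "\<dots> = (\<Sum>n. emeasure M (?U \<inter> ?C n))"
      using U C disj by (intro suminf_emeasure[symmetric]) (auto simp: disjoint_family_on_def)
    finally have "of_nat (h j) * emeasure M (?U \<inter> recurrent A) \<le> (\<Sum>n. of_nat (h j) * emeasure M (?U \<inter> ?C n))"
      by (simp add: mult_left_mono ennreal_suminf_cmult)
    also have "\<dots> \<le> ?s"
    proof (intro suminf_le)
      fix n
      show "of_nat (h j) * emeasure M (?U \<inter> ?C n) \<le> of_nat (Suc n) * emeasure M (?C n)"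
      proof (cases "?U \<inter> ?C n = {}")
        case False
        then have "h j < Suc n"
          using height_less_return_time[OF sets.sets_into_space[OF A] sets.sets_into_space[OF E] avoid]
          by blast
        then have "(of_nat (h j) :: ennreal) \<le> of_nat (Suc n)" by (intro of_nat_mono) simp
        then show ?thesis using C by (intro mult_mono emeasure_mono) auto
      qed simp
    qed auto
    finally show ?thesis
      by (simp add: emeasure_eq_measure ennreal_mult ennreal_of_nat_eq_real_of_nat)
  qed
  then have ge: "ennreal c \<le> ?s" for c
    using big[of c] by (meson ennreal_leI order_trans)
  have "?s = \<infinity>"
  proof (cases ?s)
    case (real r)
    then show ?thesis using ge[of "r + 1"] by simp
  qed simp
  then show ?thesis using tower_return[OF A] by (simp add: fat_tower_def)
qed

section \<open>Choice of the set and the final estimate\<close>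

theorem exists_fat_tower:
  assumes ap: "aperiodic M \<tau>"
  shows "\<exists>B k. fat_tower M \<tau> B k"
proof -
  \<comment> \<open>With 4^j of 8^(j+1) levels kept, the measures are at most 2^-j / 8 and summable,
    but multiplied by 4^j they can grow like 2^j. The extra factor 8 keeps the sum down to
    1/4.\<close>
  have "\<exists>E. maximal_base (8 ^ Suc j) E" for j
    by (rule exists_maximal_base[OF ap]) simp
  then obtain E where base: "\<And>j. maximal_base (8 ^ Suc j) (E j)" by metis
  note E = maximal_baseD(1)[OF base] and disj = maximal_baseD(2)[OF base]
    and cover = maximal_baseD(3)[OF base]
  define U where "U j = (\<Union>i<4 ^ j. (\<tau> ^^ i) ` E j)" for j
  define A where "A = space M - (\<Union>j. U j)"
  have le: "(4::nat) ^ j \<le> 8 ^ Suc j" for j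
    using power_mono[of "4::nat" 8 j] by (simp only: power_Suc) linarith
  have U: "U j \<in> sets M" for j unfolding U_def using E by simp
  then have A: "A \<in> sets M" unfolding A_def by simp
  have U_le: "measure M (U j) \<le> (1/8) * (1/2) ^ j" for j
  proof -
    \<comment> \<open>All 8^(j+1) disjoint levels fit into a probability space.\<close>
    have "8 ^ Suc j * measure M (E j) \<le> 1"
      using measure_levels[OF E disj, of "8 ^ Suc j" j] by (metis of_nat_numeral of_nat_power prob_le_1)
    moreover have "measure M (U j) = 4 ^ j * measure M (E j)"
      unfolding U_def using measure_levels[OF E disj, of "4 ^ j" j] le[of j] by simp
    ultimately show ?thesis
      by (simp add: field_simps power_mult_distrib[symmetric])
  qed
  have sums: "(\<lambda>j. (1/8) * (1/2::real) ^ j) sums (1/4)"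
    using sums_mult[OF geometric_sums[of "1/2::real"], of "1/8"] by simp
  have "summable (\<lambda>j. measure M (U j))"
    by (rule summable_comparison_test'[OF sums_summable[OF sums]]) (use U_le in auto)
  then have "measure M (\<Union>j. U j) \<le> (\<Sum>j. measure M (U j))"
    using U by (intro finite_measure_subadditive_countably) auto
  also have "\<dots> \<le> 1/4"
    using suminf_le[OF U_le \<open>summable _\<close> sums_summable[OF sums]] sums_unique[OF sums] by simp
  finally have "3/4 \<le> measure M A"
    unfolding A_def using U by (subst prob_compl) auto
  \<comment> \<open>2 * 3/4 - 1 = 1/2.\<close>
  then have Z_ge: "1/2 \<le> measure M (recurrent A)"
    using measure_recurrent_ge[OF A] by simp
  have Z: "recurrent A \<in> sets M" using A by (rule recurrent_sets)
  have inv: "\<tau> x \<in> recurrent A \<longleftrightarrow> x \<in> recurrent A" if "x \<in> space M" for x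
    using sets.sets_into_space[OF A] that by (rule recurrent_invariant)
  \<comment> \<open>The covering bound gives \<open>8 ^ j * measure M ?E\<close> at least 1/32, from
    1/2 divided by 2 * 8. The 4^j levels and the weight 4^j contribute 16^j = 2^j * 8^j.\<close>
  have big: "2 ^ j / 32 \<le> 4 ^ j * measure M (U j \<inter> recurrent A)" for j
  proof -
    let ?E = "E j \<inter> recurrent A"
    have E_ge: "1/2 \<le> 2 * 8 ^ Suc j * measure M ?E"
      using measure_invariant_le[OF Z inv E cover, of j] Z_ge by simp
    have "4 ^ j * measure M ?E \<le> measure M (U j \<inter> recurrent A)"
    proof -
      have "?E \<inter> (\<tau> ^^ n) ` ?E = {}" if "0 < n" "n < 4 ^ j" for n
        using disj[of n j] that le[of j] by auto
      then have "measure M (\<Union>i<4 ^ j. (\<tau> ^^ i) ` ?E) = 4 ^ j * measure M ?E"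
        using measure_levels[of ?E "4 ^ j"] E Z by simp
      \<comment> \<open>Invariance keeps every level over \<open>?E\<close> inside
        \<open>recurrent A\<close>.\<close>
      moreover have "(\<tau> ^^ i) x \<in> recurrent A" if "x \<in> recurrent A" for i x
        using that sets.sets_into_space[OF Z] by (induction i) (auto simp: inv funpow_space)
      then have "(\<Union>i<4 ^ j. (\<tau> ^^ i) ` ?E) \<subseteq> U j \<inter> recurrent A"
        unfolding U_def by blast
      then have "measure M (\<Union>i<4 ^ j. (\<tau> ^^ i) ` ?E) \<le> measure M (U j \<inter> recurrent A)"
        using U Z by (intro finite_measure_mono) auto
      ultimately show ?thesis by simp
    qed
    then have "4 ^ j * (4 ^ j * measure M ?E) \<le> 4 ^ j * measure M (U j \<inter> recurrent A)"
      by (intro mult_left_mono) auto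
    moreover have "(4::real) ^ j * 4 ^ j = 2 ^ j * 8 ^ j" by (simp add: power_mult_distrib[symmetric])
    ultimately have "2 ^ j * (8 ^ j * measure M ?E) \<le> 4 ^ j * measure M (U j \<inter> recurrent A)"
      by (simp add: mult.assoc[symmetric])
    moreover have "2 ^ j * (1/32) \<le> 2 ^ j * (8 ^ j * measure M ?E)"
      using E_ge by (intro mult_left_mono) auto
    ultimately show ?thesis by linarith
  qed
  have "\<exists>j. c \<le> (4 ^ j :: nat) * measure M (U j \<inter> recurrent A)" for c :: real
  proof -
    obtain j where "32 * c < 2 ^ j" using real_arch_pow[of 2] by auto
    then have "c \<le> 2 ^ j / 32" by simp
    with big[of j] show ?thesis by (intro exI[of _ j]) simp
  qed
  then have "fat_tower M \<tau> (\<lambda>n. return_set A (Suc n)) Suc"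
    unfolding U_def by (intro fat_tower_return[of A E "\<lambda>j. 4 ^ j"] A E) (auto simp: A_def U_def)
  then show ?thesis by blast
qed

end

theorem theorem4p1:
  fixes M :: "'a measure" and \<tau> :: "'a \<Rightarrow> 'a"
  assumes "prob_space M"
    and "nonatomic M"
    and "invertible_transformation M \<tau>"
    and "aperiodic M \<tau>"
    and "measure_preserving M \<tau>"
  shows "\<exists>(B :: nat \<Rightarrow> 'a set) (k :: nat \<Rightarrow> nat). fat_tower M \<tau> B k"
proof -
  interpret prob_space M by fact
  interpret invertible_mpt M \<tau> by unfold_locales fact+
  show ?thesis using assms(4) by (rule exists_fat_tower)
qed

end
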